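(* For every workload $\mathcal T$ with global balancing ratio $\beta$, Algorithm Clairvoyant satisfies $$CR_{Clairvoyant}(\mathcal T)\le 32\,\ell\sqrt{s/\beta}+1=O\!\left(\ell\sqrt{s/\beta}\right).$$ In particular, for balanced workloads ($\beta=\Theta(1)$) with $\ell=O(1)$, $CR_{Clairvoyant}(\mathcal T)=O(\sqrt s)$.
   Context: Model. A workload is a set $\mathcal T=\{T_1,\dots,T_n\}$ of $n\ge1$ transactions (one per thread), all issued at time $0$, over a set $\mathcal R=\{R_1,\dots,R_s\}$ of $s$ shared resources. Each transaction $T$ reads the resources in $\mathcal R_r(T)$ and writes those in $\mathcal R_w(T)$; $\mathcal R(T)=\mathcal R_r(T)\cup\mathcal R_w(T)$, $\lambda(T)=|\mathcal R(T)|\ge1$, $\lambda_w(T)=|\mathcal R_w(T)|$. $T$ is read-only if $\lambda_w(T)=0$ and writing otherwise; at least one transaction is writing. Transactions $T,T'$ conflict if some resource lies in $(\mathcal R_w(T)\cap\mathcal R(T'))\cup(\mathcal R(T)\cap\mathcal R_w(T'))$; the conflict graph has the transactions as vertices and an edge between each conflicting pair. Time is discrete and synchronous; each transaction $T_i$ has a fixed integer execution time $\tau_i\ge1$ and commits once it has executed $\tau_i$ consecutive time steps without being aborted. Whenever two running transactions conflict, the contention manager aborts one of them; an aborted transaction restarts immediately from scratch (greedy schedule). The makespan of an algorithm on a workload is the time until all its transactions have committed; $\mathrm{makespan}_{opt}$ is the minimum makespan of any schedule in which conflicting transactions never execute simultaneously (optimal offline scheduler); the competitive ratio is $CR_{\mathcal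 A}=\mathrm{makespan}_{\mathcal A}/\mathrm{makespan}_{opt}$. The balancing ratio of a writing transaction is $\beta(T)=\lambda_w(T)/\lambda(T)\in[1/s,1]$; the global balancing ratio $\beta$ is the minimum of $\beta(T)$ over writing transactions. $\tau_{\max}=\max_i\tau_i$, $\tau_{\min}=\min_i\tau_i$, $\ell=\lceil\log_2(\tau_{\max}/\tau_{\min})\rceil+1$. Grouping. Writing transactions are partitioned into groups $A_0,\dots,A_{\ell-1}$, where $A_i$ contains those with execution time in $[2^i\tau_{\min},(2^{i+1}-1)\tau_{\min}]$; each $A_i$ is partitioned into subgroups $A_i^0,\dots,A_i^{\kappa-1}$, $\kappa=\lceil\log_2 s\rceil+1$, where $A_i^j$ contains those $T$ with $\lambda(T)\in[\lambda^j_{\min},\lambda^j_{\max}]$, $\lambda^j_{\min}=2^j$, $\lambda^j_{\max}=2^{j+1}-1$. Read-only transactions form a group $B$. Subgroups are ordered by $A_i^j<A_k^l$ iff $i<k$ or ($i=k$ and $j<l$), and $B$ is placed after all subgroups. Algorithm Clairvoyant. At each time step $t$: let $\mathcal T_t$ be the set of pending (not yet committed) transactions; $\hat A_t$ the lowest-order subgroup (or $B$) containing pending transactions; $\hat{\mathcal T}_t$ the pending transactions of $\hat A_t$; $\hat S_t\subseteq\hat{\mathcal T}_t$ those that started their current execution before $t$ and have neither committed nor been aborted; $\hat S'_t$ the transactions of $\mathcal T_t$ conflicting with some transaction of $\hat S_t$; $\hat I_t$ a maximal independent set of the conflict graph induced on $\hat{\mathcal T}_t\setminus\hat S'_t$.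 Transactions in $\Pi^h_t=\hat I_t\cup\hat S_t$ get high priority, all others in $\mathcal T_t$ get low priority. All pending transactions execute; on a conflict, a high-priority transaction aborts a low-priority one, and conflicts between transactions of equal priority are resolved arbitrarily.
   Formalization: Time groups are taken as 2^i τ_min ≤ τ < 2^{i+1} τ_min, since the stated intervals leave gaps when τ_min > 1 (e.g. τ_min = 2, τ = 3); the O-form and the "in particular" O(√s) clause, immediate from the bound, are not stated separately. *)

theory Defs
  imports Complex_Main
begin

text \<open>Workload: transactions 0..<n, resources 0..<s; Rr i / Rw i are the read / write sets
  of transaction i, tau i its execution time.\<close>

definition RS :: "(nat \<Rightarrow> nat set) \<Rightarrow> (nat \<Rightarrow> nat set) \<Rightarrow> nat \<Rightarrow> nat set" where
  "RS Rr Rw i = Rr i \<union> Rw i"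

definition workload ::
  "nat \<Rightarrow> nat \<Rightarrow> (nat \<Rightarrow> nat set) \<Rightarrow> (nat \<Rightarrow> nat set) \<Rightarrow> (nat \<Rightarrow> nat) \<Rightarrow> bool" where
  "workload n s Rr Rw tau \<longleftrightarrow> n \<ge> 1 \<and>
     (\<forall>i<n. Rr i \<subseteq> {..<s} \<and> Rw i \<subseteq> {..<s} \<and> RS Rr Rw i \<noteq> {} \<and> tau i \<ge> 1) \<and>
     (\<exists>i<n. Rw i \<noteq> {})"

definition writing :: "(nat \<Rightarrow> nat set) \<Rightarrow> nat \<Rightarrow> bool" where
  "writing Rw i \<longleftrightarrow> Rw i \<noteq> {}"

definition conflict :: "(nat \<Rightarrow> nat set) \<Rightarrow> (nat \<Rightarrow> nat set) \<Rightarrow> nat \<Rightarrow> nat \<Rightarrow> bool" where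
  "conflict Rr Rw i j \<longleftrightarrow> i \<noteq> j \<and>
     (Rw i \<inter> RS Rr Rw j \<noteq> {} \<or> RS Rr Rw i \<inter> Rw j \<noteq> {})"

definition independent :: "(nat \<Rightarrow> nat set) \<Rightarrow> (nat \<Rightarrow> nat set) \<Rightarrow> nat set \<Rightarrow> bool" where
  "independent Rr Rw X \<longleftrightarrow> (\<forall>i\<in>X. \<forall>j\<in>X. \<not> conflict Rr Rw i j)"

definition tau_min :: "nat \<Rightarrow> (nat \<Rightarrow> nat) \<Rightarrow> nat" where
  "tau_min n tau = Min (tau ` {..<n})"

definition tau_max :: "nat \<Rightarrow> (nat \<Rightarrow> nat) \<Rightarrow> nat" where
  "tau_max n tau = Max (tau ` {..<n})"

definition ell :: "nat \<Rightarrow> (nat \<Rightarrow> nat) \<Rightarrow> real" where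
  "ell n tau = of_int \<lceil>log 2 (real (tau_max n tau) / real (tau_min n tau))\<rceil> + 1"

definition beta :: "nat \<Rightarrow> (nat \<Rightarrow> nat set) \<Rightarrow> (nat \<Rightarrow> nat set) \<Rightarrow> real" where
  "beta n Rr Rw = Min {real (card (Rw i)) / real (card (RS Rr Rw i)) | i. i < n \<and> writing Rw i}"

text \<open>Group index: A_g holds those with 2^g tau_min \<le> tau < 2^(g+1) tau_min.\<close>
definition tgroup :: "nat \<Rightarrow> (nat \<Rightarrow> nat) \<Rightarrow> nat \<Rightarrow> nat" where
  "tgroup n tau i = (LEAST g. tau i < 2 ^ Suc g * tau_min n tau)"

text \<open>Subgroup index: A_g^j holds those with 2^j \<le> lambda \<le> 2^(j+1) - 1.\<close>
definition lgroup :: "(nat \<Rightarrow> nat set) \<Rightarrow> (nat \<Rightarrow> nat set) \<Rightarrow> nat \<Rightarrow> nat" where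
  "lgroup Rr Rw i = (LEAST j. card (RS Rr Rw i) < 2 ^ Suc j)"

text \<open>Order of the (sub)groups: A_i^j < A_k^l iff i<k or (i=k and j<l); B last.
  cls_le i j: the (sub)group of i is not after the (sub)group of j.\<close>
definition cls_le ::
  "nat \<Rightarrow> (nat \<Rightarrow> nat set) \<Rightarrow> (nat \<Rightarrow> nat set) \<Rightarrow> (nat \<Rightarrow> nat) \<Rightarrow> nat \<Rightarrow> nat \<Rightarrow> bool" where
  "cls_le n Rr Rw tau i j \<longleftrightarrow>
     (\<not> writing Rw j) \<or>
     (writing Rw i \<and> writing Rw j \<and>
       (tgroup n tau i < tgroup n tau j \<or>
        (tgroup n tau i = tgroup n tau j \<and> lgroup Rr Rw i \<le> lgroup Rr Rw j)))"

definition opt_makespan ::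
  "nat \<Rightarrow> (nat \<Rightarrow> nat set) \<Rightarrow> (nat \<Rightarrow> nat set) \<Rightarrow> (nat \<Rightarrow> nat) \<Rightarrow> nat" where
  "opt_makespan n Rr Rw tau = (LEAST M. \<exists>st :: nat \<Rightarrow> nat.
      (\<forall>i<n. st i + tau i \<le> M) \<and>
      (\<forall>i<n. \<forall>j<n. conflict Rr Rw i j \<longrightarrow> st i + tau i \<le> st j \<or> st j + tau j \<le> st i))"

text \<open>Executions of Algorithm Clairvoyant.  At time t (= the step [t,t+1)):
  cm t i  : transaction i has committed before step t;
  prog t i: number of consecutive steps executed in its current execution before t;
  I t     : the chosen maximal independent set \<^emph>\<open>I_t\<close>;
  victim t i j : for a conflicting pair of running transactions, the one that is aborted.\<close>

definition pending :: "nat \<Rightarrow> (nat \<Rightarrow> nat \<Rightarrow> bool) \<Rightarrow> nat \<Rightarrow> nat set" where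
  "pending n cm t = {i. i < n \<and> \<not> cm t i}"

definition low_pending ::
  "nat \<Rightarrow> (nat \<Rightarrow> nat set) \<Rightarrow> (nat \<Rightarrow> nat set) \<Rightarrow> (nat \<Rightarrow> nat) \<Rightarrow> (nat \<Rightarrow> nat \<Rightarrow> bool) \<Rightarrow> nat \<Rightarrow> nat set" where
  "low_pending n Rr Rw tau cm t =
     {i \<in> pending n cm t. \<forall>j \<in> pending n cm t. cls_le n Rr Rw tau i j}"

definition S_hat ::
  "nat \<Rightarrow> (nat \<Rightarrow> nat set) \<Rightarrow> (nat \<Rightarrow> nat set) \<Rightarrow> (nat \<Rightarrow> nat) \<Rightarrow> (nat \<Rightarrow> nat \<Rightarrow> bool)
   \<Rightarrow> (nat \<Rightarrow> nat \<Rightarrow> nat) \<Rightarrow> nat \<Rightarrow> nat set" where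
  "S_hat n Rr Rw tau cm prog t = {i \<in> low_pending n Rr Rw tau cm t. prog t i > 0}"

definition S_hat' ::
  "nat \<Rightarrow> (nat \<Rightarrow> nat set) \<Rightarrow> (nat \<Rightarrow> nat set) \<Rightarrow> (nat \<Rightarrow> nat) \<Rightarrow> (nat \<Rightarrow> nat \<Rightarrow> bool)
   \<Rightarrow> (nat \<Rightarrow> nat \<Rightarrow> nat) \<Rightarrow> nat \<Rightarrow> nat set" where
  "S_hat' n Rr Rw tau cm prog t =
     {j \<in> pending n cm t. \<exists>i \<in> S_hat n Rr Rw tau cm prog t. conflict Rr Rw i j}"

definition clairvoyant_run ::
  "nat \<Rightarrow> (nat \<Rightarrow> nat set) \<Rightarrow> (nat \<Rightarrow> nat set) \<Rightarrow> (nat \<Rightarrow> nat) \<Rightarrow>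
   (nat \<Rightarrow> nat \<Rightarrow> bool) \<Rightarrow> (nat \<Rightarrow> nat \<Rightarrow> nat) \<Rightarrow> (nat \<Rightarrow> nat set) \<Rightarrow>
   (nat \<Rightarrow> nat \<Rightarrow> nat \<Rightarrow> nat) \<Rightarrow> bool" where
  "clairvoyant_run n Rr Rw tau cm prog I victim \<longleftrightarrow>
     (\<forall>i<n. \<not> cm 0 i \<and> prog 0 i = 0) \<and>
     (\<forall>t. let P = pending n cm t;
              Th = low_pending n Rr Rw tau cm t;
              Sh = S_hat n Rr Rw tau cm prog t;
              Sh' = S_hat' n Rr Rw tau cm prog t;
              high = Sh \<union> I t;
              aborted = {victim t i j | i j. i \<in> P \<and> j \<in> P \<and> conflict Rr Rw i j}
          in
          \<comment> \<open>I t is a maximal independent set of the conflict graph induced on Th - Sh'\<close>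
          I t \<subseteq> Th - Sh' \<and> independent Rr Rw (I t) \<and>
          (\<forall>j \<in> Th - Sh' - I t. \<exists>i \<in> I t. conflict Rr Rw i j) \<and>
          \<comment> \<open>contention management: each conflicting pair of running transactions has one victim;
              a high-priority transaction aborts a low-priority one\<close>
          (\<forall>i\<in>P. \<forall>j\<in>P. conflict Rr Rw i j \<longrightarrow>
              victim t i j \<in> {i, j} \<and> victim t i j = victim t j i \<and>
              (i \<in> high \<and> j \<notin> high \<longrightarrow> victim t i j = j)) \<and>
          \<comment> \<open>state update\<close>
          (\<forall>i<n. cm t i \<longrightarrow> cm (Suc t) i) \<and>
          (\<forall>i\<in>P. i \<in> aborted \<longrightarrow> \<not> cm (Suc t) i \<and> prog (Suc t) i = 0) \<and>
          (\<forall>i\<in>P. i \<notin> aborted \<longrightarrow>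
              (if Suc (prog t i) = tau i then cm (Suc t) i
               else \<not> cm (Suc t) i \<and> prog (Suc t) i = Suc (prog t i))))"

definition all_committed :: "nat \<Rightarrow> (nat \<Rightarrow> nat \<Rightarrow> bool) \<Rightarrow> nat \<Rightarrow> bool" where
  "all_committed n cm t \<longleftrightarrow> (\<forall>i<n. cm t i)"

definition clair_makespan :: "nat \<Rightarrow> (nat \<Rightarrow> nat \<Rightarrow> bool) \<Rightarrow> nat" where
  "clair_makespan n cm = (LEAST t. all_committed n cm t)"

end

(*
  Fix the subgroup with lambda in [2^j, 2^(j+1)) inside one time group, and let W(u) be the total
  execution time of its members still pending u steps after it became active. Orienting each
  conflict towards a transaction that writes the shared resource, the transactions that write into
  the resources of T have total execution time at most lambda(T) * opt. Since of two conflicting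
  transactions only one ever waits for the other, this yields sum_{t >= u} W(t) <= D W(u) with
  D = 2^(j+1) opt, so W halves every 2D steps. The remaining duration is at most W(u), and
  initially W <= s opt / (beta 2^j). Hence the subgroup is active for at most 2Dk + W(0) / 2^k
  steps for every k. With 2^J about sqrt(s / beta), take k = 0 for j >= J and k = 2 (J - j) for
  j < J: the sum over j is then geometric and bounded by 22 sqrt(s / beta) opt.
*)
theory Submission
  imports Defs
begin

section \<open>One active phase of a subgroup, in abstract form\<close>

locale phase =
  \<comment> \<open>Time is counted from the start of the phase: \<open>H t\<close> models its
    pending members, \<open>A t\<close> those with high priority, \<open>w\<close> the execution
    times. Waiting may occur along \<open>E\<close> in either direction, but only the load along
    outgoing edges is bounded.\<close>
  fixes H A :: "nat \<Rightarrow> 'a set" and E :: "'a \<Rightarrow> 'a \<Rightarrow> bool" and w :: "'a \<Rightarrow> nat" and m D :: nat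
  assumes finite_H: "finite (H t)"
    and H_anti: "t \<le> t' \<Longrightarrow> H t' \<subseteq> H t"
    and H_ne: "t < m \<Longrightarrow> H t \<noteq> {}"
    and A_sub: "t < m \<Longrightarrow> A t \<subseteq> H t"
    and A_persist: "x \<in> A t \<Longrightarrow> t \<le> t' \<Longrightarrow> t' < m \<Longrightarrow> x \<in> H t' \<Longrightarrow> x \<in> A t'"
    and A_len: "x \<in> H 0 \<Longrightarrow> card {t. t < m \<and> x \<in> A t} \<le> w x"
    and blocked: "t < m \<Longrightarrow> x \<in> H t - A t \<Longrightarrow> \<exists>y\<in>A t. E x y \<or> E y x"
    and load: "x \<in> H 0 \<Longrightarrow> w x + (\<Sum>y\<in>H 0. if E x y then w y else 0) \<le> D"
begin

definition W :: "nat \<Rightarrow> nat" where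
  "W t = (\<Sum>x\<in>H t. w x)"

text \<open>Steps count whether or not \<open>x\<close> and \<open>y\<close> conflict; the
  restriction to \<open>E\<close> is imposed later, in the sums.\<close>

definition block :: "nat \<Rightarrow> 'a \<Rightarrow> 'a \<Rightarrow> nat" where
  "block u x y = card {t\<in>{u..<m}. x \<in> H t - A t \<and> y \<in> A t}"

lemma active_le:
  assumes "x \<in> H u"
  shows "card {t\<in>{u..<m}. x \<in> A t} \<le> w x"
proof -
  have "card {t\<in>{u..<m}. x \<in> A t} \<le> card {t. t < m \<and> x \<in> A t}"
    by (intro card_mono) auto
  also have "\<dots> \<le> w x"
    using A_len H_anti[of 0 u] assms by auto
  finally show ?thesis .
qed

lemma block_le:
  assumes "y \<in> H u"
  shows "block u x y \<le> w y"
proof -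
  have "block u x y \<le> card {t\<in>{u..<m}. y \<in> A t}"
    unfolding block_def by (intro card_mono) auto
  then show ?thesis
    using active_le[OF assms] by linarith
qed

text \<open>If each waited for the other at some step, the one active at the earlier step would by
  \<open>A_persist\<close> still be active at the later step, where it is supposed to wait.\<close>

lemma block_exclusive: "block u x y = 0 \<or> block u y x = 0"
proof (rule ccontr)
  assume "\<not> ?thesis"
  then have "{t\<in>{u..<m}. x \<in> H t - A t \<and> y \<in> A t} \<noteq> {}"
    "{t\<in>{u..<m}. y \<in> H t - A t \<and> x \<in> A t} \<noteq> {}"
    unfolding block_def by (metis card.empty)+
  then obtain t t' where "t < m" "x \<in> H t - A t" "y \<in> A t"
    "t' < m" "y \<in> H t' - A t'" "x \<in> A t'"
    by auto
  then show False
    using A_persist[of y t t'] A_persist[of x t' t] by (cases "t \<le> t'") auto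
qed

text \<open>Weighting a wait by the waiter's own execution time gives both directions the same
  bound, so it does not matter which of the two waits.\<close>

lemma block_pair_le:
  assumes "x \<in> H u" "y \<in> H u"
  shows "w x * block u x y + w y * block u y x \<le> w x * w y"
  using block_exclusive[of u x y] block_le[OF assms(1), of y] block_le[OF assms(2), of x]
  by (auto simp: mult.commute)

text \<open>At each pending step \<open>x\<close> is active or has an active neighbour, which lies
  in \<open>H u\<close> because pending sets shrink; a union bound over the neighbours
  follows.\<close>

lemma waiting_le:
  assumes "x \<in> H u"
  shows "card {t\<in>{u..<m}. x \<in> H t} \<le> w x + (\<Sum>y\<in>H u. if E x y \<or> E y x then block u x y else 0)"
proof -
  let ?B = "\<lambda>y. {t\<in>{u..<m}. x \<in> H t - A t \<and> y \<in> A t}"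
  let ?N = "{y\<in>H u. E x y \<or> E y x}"
  have "{t\<in>{u..<m}. x \<in> H t} \<subseteq> {t\<in>{u..<m}. x \<in> A t} \<union> (\<Union>y\<in>?N. ?B y)"
  proof
    fix t assume t: "t \<in> {t\<in>{u..<m}. x \<in> H t}"
    show "t \<in> {t\<in>{u..<m}. x \<in> A t} \<union> (\<Union>y\<in>?N. ?B y)"
    proof (cases "x \<in> A t")
      case False
      then obtain y where y: "y \<in> A t" "E x y \<or> E y x"
        using blocked[of t x] t by auto
      then have "y \<in> H u"
        using A_sub[of t] H_anti[of u t] t by auto
      then show ?thesis using y t False by auto
    qed (use t in auto)
  qed
  then have "card {t\<in>{u..<m}. x \<in> H t} \<le> card ({t\<in>{u..<m}. x \<in> A t} \<union> (\<Union>y\<in>?N. ?B y))"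
    using finite_H by (intro card_mono) auto
  also have "\<dots> \<le> card {t\<in>{u..<m}. x \<in> A t} + card (\<Union>y\<in>?N. ?B y)"
    by (rule card_Un_le)
  also have "card (\<Union>y\<in>?N. ?B y) \<le> (\<Sum>y\<in>?N. block u x y)"
    unfolding block_def using finite_H by (intro card_UN_le) auto
  also have "(\<Sum>y\<in>?N. block u x y) = (\<Sum>y\<in>H u. if E x y \<or> E y x then block u x y else 0)"
    using finite_H by (simp add: sum.inter_filter)
  finally show ?thesis
    using active_le[OF assms] by linarith
qed

text \<open>Every conflict is charged to the endpoint \<open>x\<close> of its orientation \<open>E x y\<close>. Of two
  conflicting transactions only one ever waits for the other, so the pair contributes at most
  \<open>w x * w y\<close>; no bound on the number of \<open>y\<close> with \<open>E y x\<close> is needed.\<close>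
lemma tail_sum_W_le: "(\<Sum>t\<in>{u..<m}. W t) \<le> D * W u"
proof -
  let ?N = "H u"
  have "(\<Sum>t\<in>{u..<m}. W t) = (\<Sum>t\<in>{u..<m}. \<Sum>x\<in>?N. if x \<in> H t then w x else 0)"
  proof (rule sum.cong[OF refl])
    fix t assume "t \<in> {u..<m}"
    then have "H t = {x\<in>?N. x \<in> H t}"
      using H_anti[of u t] by auto
    then have "W t = sum w {x\<in>?N. x \<in> H t}"
      unfolding W_def by simp
    also have "\<dots> = (\<Sum>x\<in>?N. if x \<in> H t then w x else 0)"
      by (rule sum.inter_filter[OF finite_H])
    finally show "W t = (\<Sum>x\<in>?N. if x \<in> H t then w x else 0)" .
  qed
  \<comment> \<open>Double counting: \<open>x\<close> contributes \<open>w x\<close> once for every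
    step at which it is pending.\<close>
  also have "\<dots> = (\<Sum>x\<in>?N. w x * card {t\<in>{u..<m}. x \<in> H t})"
    by (subst sum.swap) (simp add: sum.inter_filter[symmetric] mult.commute)
  also have "\<dots> \<le> (\<Sum>x\<in>?N. w x * (w x + (\<Sum>y\<in>?N. if E x y \<or> E y x then block u x y else 0)))"
    by (intro sum_mono mult_left_mono waiting_le) auto
  also have "\<dots> \<le> (\<Sum>x\<in>?N. w x * w x + (\<Sum>y\<in>?N. if E x y then w x * block u x y else 0)
      + (\<Sum>y\<in>?N. if E y x then w x * block u x y else 0))"
    unfolding distrib_left sum_distrib_left add.assoc sum.distrib[symmetric]
    by (intro sum_mono add_left_mono) auto
  \<comment> \<open>Exchanging the roles of \<open>x\<close> and \<open>y\<close> in the last sum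
    puts both waiting directions of a pair under the same condition \<open>E x y\<close>, ready for
    \<open>block_pair_le\<close>.\<close>
  also have "\<dots> = (\<Sum>x\<in>?N. w x * w x) + (\<Sum>x\<in>?N. \<Sum>y\<in>?N. if E x y then w x * block u x y else 0)
      + (\<Sum>x\<in>?N. \<Sum>y\<in>?N. if E x y then w y * block u y x else 0)"
    unfolding sum.distrib by (subst (3) sum.swap) rule
  also have "\<dots> = (\<Sum>x\<in>?N. w x * w x +
      (\<Sum>y\<in>?N. if E x y then w x * block u x y + w y * block u y x else 0))"
    unfolding sum.distrib[symmetric] add.assoc
    by (intro sum.cong refl arg_cong2[where f = "(+)"]) auto
  also have "\<dots> \<le> (\<Sum>x\<in>?N. w x * w x + (\<Sum>y\<in>?N. if E x y then w x * w y else 0))"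
    using block_pair_le by (intro sum_mono add_left_mono) auto
  also have "\<dots> = (\<Sum>x\<in>?N. w x * (w x + (\<Sum>y\<in>?N. if E x y then w y else 0)))"
    by (simp add: distrib_left sum_distrib_left if_distrib cong: if_cong)
  also have "\<dots> \<le> (\<Sum>x\<in>?N. w x * D)"
  proof (intro sum_mono mult_left_mono)
    fix x assume "x \<in> ?N"
    moreover have "(\<Sum>y\<in>?N. if E x y then w y else 0) \<le> (\<Sum>y\<in>H 0. if E x y then w y else 0)"
      using finite_H H_anti[of 0 u] by (intro sum_mono2) auto
    ultimately show "w x + (\<Sum>y\<in>?N. if E x y then w y else 0) \<le> D"
      using load[of x] H_anti[of 0 u] by fastforce
  qed simp
  also have "\<dots> = D * W u"
    by (simp add: W_def mult.commute flip: sum_distrib_left)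
  finally show ?thesis .
qed

lemma W_anti: "t \<le> t' \<Longrightarrow> W t' \<le> W t"
  unfolding W_def using finite_H H_anti by (intro sum_mono2) auto

text \<open>The tail sum from \<open>u\<close> starts with \<open>2 * D\<close> terms, each at least
  \<open>W (u + 2 * D)\<close> by monotonicity, while the whole sum is at most
  \<open>D * W u\<close>.\<close>

lemma W_halves:
  assumes "0 < D" "u + 2 * D \<le> m"
  shows "2 * W (u + 2 * D) \<le> W u"
proof -
  have "2 * D * W (u + 2 * D) = (\<Sum>t\<in>{u..<u + 2 * D}. W (u + 2 * D))"
    by simp
  also have "\<dots> \<le> (\<Sum>t\<in>{u..<u + 2 * D}. W t)"
    by (intro sum_mono W_anti) auto
  also have "\<dots> \<le> (\<Sum>t\<in>{u..<m}. W t)"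
    using assms by (intro sum_mono2) auto
  also have "\<dots> \<le> D * W u"
    by (rule tail_sum_W_le)
  finally have "D * (2 * W (u + 2 * D)) \<le> D * W u"
    by simp
  then show ?thesis
    using assms by simp
qed

text \<open>Some member is active at every step: a pending one is active itself or is blocked by an
  active one. Each member is active for at most \<open>w\<close> steps.\<close>

lemma remaining_le_W: "m - u \<le> W u"
proof -
  have "{u..<m} \<subseteq> (\<Union>x\<in>H u. {t\<in>{u..<m}. x \<in> A t})"
  proof
    fix t assume t: "t \<in> {u..<m}"
    then obtain x where "x \<in> H t"
      using H_ne by auto
    then obtain y where "y \<in> A t"
      using blocked[of t x] t by auto
    then show "t \<in> (\<Union>x\<in>H u. {t\<in>{u..<m}. x \<in> A t})"
      using t A_sub[of t] H_anti[of u t] by auto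
  qed
  then have "card {u..<m} \<le> card (\<Union>x\<in>H u. {t\<in>{u..<m}. x \<in> A t})"
    using finite_H by (intro card_mono) auto
  also have "\<dots> \<le> (\<Sum>x\<in>H u. card {t\<in>{u..<m}. x \<in> A t})"
    using finite_H by (intro card_UN_le) auto
  also have "\<dots> \<le> W u"
    unfolding W_def by (intro sum_mono active_le)
  finally show ?thesis by simp
qed

text \<open>Wait for \<open>k\<close> halvings, then bound the rest by the remaining weight. If the
  phase ends before that, the first summand alone suffices. The parameter \<open>k\<close> stays
  free to be tuned for each subgroup.\<close>

lemma length_le:
  assumes "0 < D"
  shows "real m \<le> 2 * real D * real k + real (W 0) / 2 ^ k"
proof (cases "2 * D * k \<le> m")
  case True
  have "2 * D * i \<le> m \<Longrightarrow> 2 ^ i * W (2 * D * i) \<le> W 0" for i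
  proof (induction i)
    case (Suc i)
    have "2 ^ Suc i * W (2 * D * Suc i) = 2 ^ i * (2 * W (2 * D * i + 2 * D))"
      by (simp add: algebra_simps)
    also have "\<dots> \<le> 2 ^ i * W (2 * D * i)"
      using Suc.prems by (intro mult_left_mono W_halves assms) (auto simp: algebra_simps)
    also have "\<dots> \<le> W 0"
      using Suc by simp
    finally show ?case .
  qed simp
  from this[OF True] have "real (2 ^ k * W (2 * D * k)) \<le> real (W 0)"
    by (simp only: of_nat_le_iff)
  then have "real (W (2 * D * k)) \<le> real (W 0) / 2 ^ k"
    by (simp add: field_simps)
  moreover have "real m \<le> real (2 * D * k) + real (W (2 * D * k))"
    using remaining_le_W[of "2 * D * k"] by linarith
  ultimately show ?thesis by simp
next
  case False
  then have "real m \<le> real (2 * D * k)"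
    by (simp only: of_nat_le_iff)
  also have "\<dots> \<le> 2 * real D * real k + real (W 0) / 2 ^ k"
    by simp
  finally show ?thesis .
qed

end

section \<open>Summing the subgroup bounds geometrically\<close>

lemma sum_class_bounds_le:
  fixes f :: "nat \<Rightarrow> real" and Q :: real
  assumes Q: "1 \<le> Q" and f: "\<And>j k. f j \<le> 4 * real k * 2 ^ j + Q\<^sup>2 / (2 ^ j * 2 ^ k)"
  shows "(\<Sum>j<K. f j) \<le> 32 * Q"
proof -
  \<comment> \<open>This is the crossover: \<open>2 ^ J\<close> and \<open>Q\<^sup>2 / 2 ^ J\<close>
    are both within a factor 2 of \<open>Q\<close>.\<close>
  define J where "J = nat \<lfloor>log 2 Q\<rfloor>"
  have l0: "0 \<le> log 2 Q" using Q by simp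
  have "real J \<le> log 2 Q" "log 2 Q < real J + 1"
    unfolding J_def using l0 by linarith+
  then have "2 powr real J \<le> Q" "Q < 2 powr (real J + 1)"
    using Q by (auto simp: le_log_iff log_less_iff)
  then have J: "2 ^ J \<le> Q" "Q < 2 * 2 ^ J"
    by (auto simp: powr_add powr_realpow)
  \<comment> \<open>Here \<open>k = 0\<close>. The factor \<open>1 - 1 / 2 ^ p\<close> is the exact
    partial geometric sum, which lets the induction close.\<close>
  have large: "(\<Sum>j=J..<J+p. f j) \<le> 2 * Q\<^sup>2 / 2 ^ J * (1 - 1 / 2 ^ p)" for p
  proof (induction p)
    case (Suc p)
    have "(\<Sum>j=J..<J+Suc p. f j) = (\<Sum>j=J..<J+p. f j) + f (J + p)"
      by simp
    also have "\<dots> \<le> 2 * Q\<^sup>2 / 2 ^ J * (1 - 1 / 2 ^ p) + Q\<^sup>2 / (2 ^ J * 2 ^ p)"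
      using Suc f[of "J + p" 0] by (simp add: power_add)
    also have "\<dots> = 2 * Q\<^sup>2 / 2 ^ J * (1 - 1 / 2 ^ Suc p)"
      by (simp add: field_simps)
    finally show ?case .
  qed simp
  have QJ: "Q\<^sup>2 / 2 ^ J \<le> 2 * Q"
    using J Q by (simp add: divide_le_eq power2_eq_square mult.assoc)
  have large': "(\<Sum>j=J..<J+p. f j) \<le> 4 * Q" for p
  proof -
    have "2 * Q\<^sup>2 / 2 ^ J * (1 - 1 / 2 ^ p) \<le> 2 * Q\<^sup>2 / 2 ^ J * 1"
      by (intro mult_left_mono) auto
    then show ?thesis using large[of p] QJ by simp
  qed
  \<comment> \<open>With \<open>k = 2 * (J - j)\<close> the denominator \<open>2 ^ j * 2 ^ k\<close>
    equals \<open>2 ^ J * 2 ^ J / 2 ^ j\<close>, so the second term becomes geometric and increasing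
    in \<open>j\<close>.\<close>
  have small: "f j \<le> 8 * real (J - j) * 2 ^ j + Q\<^sup>2 / 2 ^ J * (2 ^ j / 2 ^ J)" if "j < J" for j
  proof -
    have "2 ^ j * 2 ^ (2 * (J - j)) * 2 ^ j = (2 ^ J * 2 ^ J :: real)"
      using that by (simp flip: power_add)
    then have "Q\<^sup>2 / (2 ^ j * 2 ^ (2 * (J - j))) = Q\<^sup>2 / 2 ^ J * (2 ^ j / 2 ^ J)"
      by (simp add: field_simps)
    then show ?thesis using f[of j "2 * (J - j)"] by simp
  qed
  have arith_geo: "(\<Sum>j<p. real (p - j) * 2 ^ j) = 2 * 2 ^ p - real p - 2"
    "(\<Sum>j<p. 2 ^ j :: real) = 2 ^ p - 1" for p :: nat
  proof -
    show *: "(\<Sum>j<p. 2 ^ j :: real) = 2 ^ p - 1" for p :: nat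
      by (induction p) auto
    show "(\<Sum>j<p. real (p - j) * 2 ^ j) = 2 * 2 ^ p - real p - 2"
    proof (induction p)
      case (Suc p)
      have "(\<Sum>j<Suc p. real (Suc p - j) * 2 ^ j) = (\<Sum>j<Suc p. real (p - j) * 2 ^ j + 2 ^ j)"
        by (intro sum.cong) (auto simp: Suc_diff_le algebra_simps)
      \<comment> \<open>The summand \<open>j = p\<close> of the first part vanishes.\<close>
      also have "\<dots> = (\<Sum>j<p. real (p - j) * 2 ^ j) + (\<Sum>j<Suc p. 2 ^ j)"
        by (simp add: sum.distrib)
      finally show ?case using Suc *[of "Suc p"] by simp
    qed simp
  qed
  have f_small: "(\<Sum>j<p. f j) \<le> 18 * Q" if "p \<le> J" for p
  proof -
    have "(\<Sum>j<p. f j) \<le> (\<Sum>j<p. 8 * real (J - j) * 2 ^ j + Q\<^sup>2 / 2 ^ J * (2 ^ j / 2 ^ J))"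
      using that by (intro sum_mono small) auto
    \<comment> \<open>The range is extended only after \<open>f\<close> has been replaced by its
      bound, since \<open>f\<close> may take negative values.\<close>
    also have "\<dots> \<le> (\<Sum>j<J. 8 * real (J - j) * 2 ^ j + Q\<^sup>2 / 2 ^ J * (2 ^ j / 2 ^ J))"
      using that by (intro sum_mono2) auto
    also have "\<dots> = 8 * (\<Sum>j<J. real (J - j) * 2 ^ j) + Q\<^sup>2 / 2 ^ J * ((\<Sum>j<J. 2 ^ j) / 2 ^ J)"
      unfolding sum.distrib sum_distrib_left sum_divide_distrib mult.assoc ..
    also have "\<dots> \<le> 8 * (2 * 2 ^ J) + Q\<^sup>2 / 2 ^ J * 1"
      unfolding arith_geo by (intro add_mono mult_left_mono) auto
    also have "\<dots> \<le> 18 * Q"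
      using J QJ by linarith
    finally show ?thesis .
  qed
  \<comment> \<open>The two ranges contribute \<open>18 * Q\<close> and \<open>4 * Q\<close>, so the
    constant 32 leaves slack.\<close>
  show ?thesis
  proof (cases "K \<le> J")
    case True
    then show ?thesis using f_small[of K] Q by linarith
  next
    case False
    then have "(\<Sum>j<K. f j) = (\<Sum>j<J. f j) + (\<Sum>j=J..<J+(K-J). f j)"
      by (subst sum.atLeastLessThan_concat[of 0 J K f, simplified lessThan_atLeast0[symmetric], symmetric]) auto
    then show ?thesis using f_small[of J] large'[of "K - J"] Q by linarith
  qed
qed


section \<open>Runs of the algorithm: high priority lasts until commitment\<close>

locale execution =
  fixes n s :: nat and Rr Rw :: "nat \<Rightarrow> nat set" and tau :: "nat \<Rightarrow> nat"
    and cm :: "nat \<Rightarrow> nat \<Rightarrow> bool" and prog :: "nat \<Rightarrow> nat \<Rightarrow> nat"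
    and I :: "nat \<Rightarrow> nat set" and victim :: "nat \<Rightarrow> nat \<Rightarrow> nat \<Rightarrow> nat"
  assumes wl: "workload n s Rr Rw tau"
    and run: "clairvoyant_run n Rr Rw tau cm prog I victim"
begin

abbreviation P where "P \<equiv> pending n cm"
abbreviation Th where "Th \<equiv> low_pending n Rr Rw tau cm"
abbreviation Sh where "Sh \<equiv> S_hat n Rr Rw tau cm prog"
abbreviation Sh' where "Sh' \<equiv> S_hat' n Rr Rw tau cm prog"
abbreviation conf where "conf \<equiv> conflict Rr Rw"
abbreviation le where "le \<equiv> cls_le n Rr Rw tau"
abbreviation opt where "opt \<equiv> opt_makespan n Rr Rw tau"

definition high :: "nat \<Rightarrow> nat set" where
  "high t = Sh t \<union> I t"

definition aborted :: "nat \<Rightarrow> nat set" where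
  "aborted t = {victim t i j | i j. i \<in> P t \<and> j \<in> P t \<and> conf i j}"

lemma tau_pos: "i < n \<Longrightarrow> 1 \<le> tau i"
  and RS_sub: "i < n \<Longrightarrow> RS Rr Rw i \<subseteq> {..<s}"
  and RS_ne: "i < n \<Longrightarrow> RS Rr Rw i \<noteq> {}"
  and n_pos: "0 < n"
  and ex_writing: "\<exists>i<n. writing Rw i"
  using wl unfolding workload_def RS_def writing_def by auto

lemma init: "i < n \<Longrightarrow> \<not> cm 0 i \<and> prog 0 i = 0"
  using run unfolding clairvoyant_run_def by blast

lemma I_sub: "I t \<subseteq> Th t - Sh' t"
  and I_indep: "independent Rr Rw (I t)"
  and I_maximal: "j \<in> Th t - Sh' t - I t \<Longrightarrow> \<exists>i\<in>I t. conf i j"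
  and victim_in: "i \<in> P t \<Longrightarrow> j \<in> P t \<Longrightarrow> conf i j \<Longrightarrow> victim t i j \<in> {i, j}"
  and victim_sym: "i \<in> P t \<Longrightarrow> j \<in> P t \<Longrightarrow> conf i j \<Longrightarrow> victim t i j = victim t j i"
  and victim_low: "i \<in> P t \<Longrightarrow> j \<in> P t \<Longrightarrow> conf i j \<Longrightarrow> i \<in> high t \<Longrightarrow> j \<notin> high t \<Longrightarrow> victim t i j = j"
  and cm_Suc: "i < n \<Longrightarrow> cm t i \<Longrightarrow> cm (Suc t) i"
  and step_aborted: "i \<in> P t \<Longrightarrow> i \<in> aborted t \<Longrightarrow> \<not> cm (Suc t) i \<and> prog (Suc t) i = 0"
  and step_commit: "i \<in> P t \<Longrightarrow> i \<notin> aborted t \<Longrightarrow> Suc (prog t i) = tau i \<Longrightarrow> cm (Suc t) i"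
  and step_run: "i \<in> P t \<Longrightarrow> i \<notin> aborted t \<Longrightarrow> Suc (prog t i) \<noteq> tau i \<Longrightarrow>
        prog (Suc t) i = Suc (prog t i)"
proof -
  have "I t \<subseteq> Th t - Sh' t \<and> independent Rr Rw (I t) \<and>
          (\<forall>j \<in> Th t - Sh' t - I t. \<exists>i \<in> I t. conf i j) \<and>
          (\<forall>i\<in>P t. \<forall>j\<in>P t. conf i j \<longrightarrow>
              victim t i j \<in> {i, j} \<and> victim t i j = victim t j i \<and>
              (i \<in> high t \<and> j \<notin> high t \<longrightarrow> victim t i j = j)) \<and>
          (\<forall>i<n. cm t i \<longrightarrow> cm (Suc t) i) \<and>
          (\<forall>i\<in>P t. i \<in> aborted t \<longrightarrow> \<not> cm (Suc t) i \<and> prog (Suc t) i = 0) \<and>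
          (\<forall>i\<in>P t. i \<notin> aborted t \<longrightarrow>
              (if Suc (prog t i) = tau i then cm (Suc t) i
               else \<not> cm (Suc t) i \<and> prog (Suc t) i = Suc (prog t i)))"
    using run unfolding clairvoyant_run_def Let_def high_def aborted_def
    by (elim conjE) (erule spec)
  then have indep: "I t \<subseteq> Th t - Sh' t" "independent Rr Rw (I t)"
      "\<forall>j \<in> Th t - Sh' t - I t. \<exists>i \<in> I t. conf i j"
    and victims: "\<forall>i\<in>P t. \<forall>j\<in>P t. conf i j \<longrightarrow>
              victim t i j \<in> {i, j} \<and> victim t i j = victim t j i \<and>
              (i \<in> high t \<and> j \<notin> high t \<longrightarrow> victim t i j = j)"
    and commit: "\<forall>i<n. cm t i \<longrightarrow> cm (Suc t) i"
    and abort: "\<forall>i\<in>P t. i \<in> aborted t \<longrightarrow> \<not> cm (Suc t) i \<and> prog (Suc t) i = 0"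
    and continue: "\<forall>i\<in>P t. i \<notin> aborted t \<longrightarrow>
              (if Suc (prog t i) = tau i then cm (Suc t) i
               else \<not> cm (Suc t) i \<and> prog (Suc t) i = Suc (prog t i))"
    by - (elim conjE, assumption)+
  show "I t \<subseteq> Th t - Sh' t" "independent Rr Rw (I t)"
    by (rule indep)+
  show "j \<in> Th t - Sh' t - I t \<Longrightarrow> \<exists>i\<in>I t. conf i j"
    using indep(3) by (rule bspec)
  show "i \<in> P t \<Longrightarrow> j \<in> P t \<Longrightarrow> conf i j \<Longrightarrow> victim t i j \<in> {i, j}"
    "i \<in> P t \<Longrightarrow> j \<in> P t \<Longrightarrow> conf i j \<Longrightarrow> victim t i j = victim t j i"
    "i \<in> P t \<Longrightarrow> j \<in> P t \<Longrightarrow> conf i j \<Longrightarrow> i \<in> high t \<Longrightarrow> j \<notin> high t \<Longrightarrow> victim t i j = j"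
    using victims[THEN bspec, of i, THEN bspec, of j] by blast+
  show "i < n \<Longrightarrow> cm t i \<Longrightarrow> cm (Suc t) i"
    using commit by simp
  show "i \<in> P t \<Longrightarrow> i \<in> aborted t \<Longrightarrow> \<not> cm (Suc t) i \<and> prog (Suc t) i = 0"
    using abort by simp
  show "i \<in> P t \<Longrightarrow> i \<notin> aborted t \<Longrightarrow> Suc (prog t i) = tau i \<Longrightarrow> cm (Suc t) i"
    "i \<in> P t \<Longrightarrow> i \<notin> aborted t \<Longrightarrow> Suc (prog t i) \<noteq> tau i \<Longrightarrow>
        prog (Suc t) i = Suc (prog t i)"
    using continue by simp_all
qed

lemma conf_sym: "conf i j \<longleftrightarrow> conf j i"
  unfolding conflict_def by blast

lemma finite_P: "finite (P t)"
  unfolding pending_def by simp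

lemma P_anti: "t \<le> t' \<Longrightarrow> P t' \<subseteq> P t"
proof (induction t' rule: dec_induct)
  case (step t')
  then show ?case using cm_Suc unfolding pending_def by blast
qed simp

lemma Th_sub: "Th t \<subseteq> P t"
  unfolding low_pending_def by blast

text \<open>A transaction that completes its last step commits instead of staying pending, and an
  abort resets progress to 0, which is below \<open>tau i\<close>.\<close>

lemma prog_less: "i \<in> P t \<Longrightarrow> prog t i < tau i"
proof (induction t)
  case 0
  then show ?case using init[of i] tau_pos[of i] by (auto simp: pending_def)
next
  case (Suc t)
  then have i: "i \<in> P t" "\<not> cm (Suc t) i" "i < n"
    using P_anti[of t "Suc t"] by (auto simp: pending_def)
  show ?case
  proof (cases "i \<in> aborted t")
    case True
    then show ?thesis using step_aborted[OF i(1)] tau_pos[OF i(3)] by simp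
  next
    case False
    then have "Suc (prog t i) \<noteq> tau i"
      using step_commit[OF i(1)] i(2) by blast
    then show ?thesis using step_run[OF i(1) False] Suc.IH[OF i(1)] by simp
  qed
qed

text \<open>Both would have been pending one step earlier; the victim of that conflict then has
  progress 0 now. At time 0 all progress is 0.\<close>

lemma running_no_conflict:
  assumes "i \<in> P t" "j \<in> P t" "0 < prog t i" "0 < prog t j"
  shows "\<not> conf i j"
proof (cases t)
  case 0
  then show ?thesis using assms init by (auto simp: pending_def)
next
  case (Suc t')
  show ?thesis
  proof
    assume c: "conf i j"
    have ij: "i \<in> P t'" "j \<in> P t'"
      using assms P_anti[of t' t] Suc by auto
    then have "victim t' i j \<in> aborted t'"
      using c unfolding aborted_def by blast
    then have "prog t (victim t' i j) = 0"
      using victim_in[OF ij c] step_aborted[of "victim t' i j" t'] ij Suc by auto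
    then show False using victim_in[OF ij c] assms by auto
  qed
qed

lemma high_sub: "high t \<subseteq> Th t"
  using I_sub unfolding high_def S_hat_def by blast

text \<open>Started transactions are conflict-free by \<open>running_no_conflict\<close>,
  \<open>I t\<close> is independent, and it avoids \<open>Sh' t\<close>, hence all conflicts with
  \<open>Sh t\<close>.\<close>

lemma high_indep:
  assumes "i \<in> high t" "j \<in> high t"
  shows "\<not> conf i j"
proof -
  have S: "\<not> conf i j" if "i \<in> Sh t" "j \<in> Sh t" for i j
    using that running_no_conflict Th_sub unfolding S_hat_def by blast
  have SI: "\<not> conf i j" if "i \<in> Sh t" "j \<in> I t" for i j
    using that I_sub Th_sub unfolding S_hat'_def by blast
  have "\<not> conf i j" if "i \<in> I t" "j \<in> I t"
    using that I_indep unfolding independent_def by blast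
  then show ?thesis
    using assms S SI conf_sym unfolding high_def by blast
qed

text \<open>By independence every conflicting opponent has low priority, so the opponent is the
  victim.\<close>

lemma high_not_aborted:
  assumes "i \<in> high t"
  shows "i \<notin> aborted t"
proof
  assume "i \<in> aborted t"
  then obtain a b where ab: "a \<in> P t" "b \<in> P t" "conf a b" "i = victim t a b"
    unfolding aborted_def by blast
  have "\<exists>j\<in>P t. conf i j \<and> victim t i j = i"
    using ab victim_in[OF ab(1-3)] victim_sym[OF ab(1-3)] conf_sym by auto
  then obtain j where j: "j \<in> P t" "conf i j" "victim t i j = i" by blast
  have "j \<notin> high t" using high_indep assms j by blast
  then have "victim t i j = j"
    using victim_low[of i t j] assms j high_sub Th_sub by blast
  then show False using j unfolding conflict_def by simp
qed

text \<open>Membership means being minimal among the pending transactions, and the pending set only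
  shrinks.\<close>

lemma Th_persist: "i \<in> Th t \<Longrightarrow> t \<le> t' \<Longrightarrow> i \<in> P t' \<Longrightarrow> i \<in> Th t'"
  using P_anti unfolding low_pending_def by blast

text \<open>A high-priority transaction survives the step, so if still pending it has positive
  progress and falls into \<open>Sh\<close> at the next step.\<close>

lemma high_run: "i \<in> high t \<Longrightarrow> t \<le> t' \<Longrightarrow> i \<in> P t' \<Longrightarrow> i \<in> high t' \<and> prog t' i = prog t i + (t' - t)"
proof (rotate_tac, induction t' rule: dec_induct)
  case (step t')
  have P: "i \<in> P t'" using step.prems P_anti[of t' "Suc t'"] by auto
  then have IH: "i \<in> high t'" "prog t' i = prog t i + (t' - t)"
    using step by auto
  have na: "i \<notin> aborted t'" by (rule high_not_aborted[OF IH(1)])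
  have "Suc (prog t' i) \<noteq> tau i"
    using step_commit[OF P na] step.prems by (auto simp: pending_def)
  then have pr: "prog (Suc t') i = Suc (prog t' i)"
    by (rule step_run[OF P na])
  have "i \<in> Th (Suc t')"
    using Th_persist[of i t' "Suc t'"] high_sub IH(1) step.prems by auto
  then have "i \<in> high (Suc t')"
    using pr unfolding high_def S_hat_def by simp
  then show ?case using pr IH(2) step.hyps by simp
qed simp

text \<open>Progress strictly increases while priority is high, so it labels these steps injectively
  by numbers below \<open>tau i\<close>.\<close>

lemma card_high_le: "card {t\<in>X. i \<in> high t} \<le> tau i"
proof -
  have P: "i \<in> P t" if "i \<in> high t" for t
    using that high_sub Th_sub by blast
  have "inj_on (\<lambda>t. prog t i) {t\<in>X. i \<in> high t}"
  proof (rule inj_onI)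
    fix t t' assume *: "t \<in> {t\<in>X. i \<in> high t}" "t' \<in> {t\<in>X. i \<in> high t}" "prog t i = prog t' i"
    then show "t = t'"
      using high_run[of i t t'] high_run[of i t' t] P by (cases "t \<le> t'") auto
  qed
  moreover have "(\<lambda>t. prog t i) ` {t\<in>X. i \<in> high t} \<subseteq> {..<tau i}"
    using P prog_less by auto
  ultimately show ?thesis
    using card_inj_on_le[of _ _ "{..<tau i}"] by fastforce
qed

lemma high_or_blocked:
  assumes "j \<in> Th t - high t"
  shows "\<exists>i\<in>high t. conf i j"
proof (cases "j \<in> Sh' t")
  case True
  then show ?thesis unfolding S_hat'_def high_def by blast
next
  case False
  then show ?thesis using I_maximal[of j t] assms unfolding high_def by blast
qed

text \<open>A lexicographic minimum taken in two rounds, first by \<open>tgroup\<close>, then by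
  \<open>lgroup\<close>. Without pending writers, every pending transaction is minimal.\<close>

lemma Th_ne:
  assumes "P t \<noteq> {}"
  shows "Th t \<noteq> {}"
proof (cases "\<exists>i\<in>P t. writing Rw i")
  case True
  let ?W = "\<lambda>i. i \<in> P t \<and> writing Rw i"
  obtain a where a: "?W a" "\<And>i. ?W i \<Longrightarrow> tgroup n tau a \<le> tgroup n tau i"
    using ex_has_least_nat[of ?W _ "tgroup n tau"] True by blast
  let ?V = "\<lambda>i. ?W i \<and> tgroup n tau i = tgroup n tau a"
  obtain b where b: "?V b" "\<And>i. ?V i \<Longrightarrow> lgroup Rr Rw b \<le> lgroup Rr Rw i"
    using ex_has_least_nat[of ?V a "lgroup Rr Rw"] a by blast
  have "le b i" if "i \<in> P t" for i
    using b a(2)[of i] that unfolding cls_le_def by (cases "writing Rw i") fastforce+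
  then show ?thesis using b unfolding low_pending_def by blast
next
  case False
  then show ?thesis using assms unfolding low_pending_def cls_le_def by blast
qed

section \<open>Lower bounds on the optimal makespan\<close>

definition is_schedule :: "(nat \<Rightarrow> nat) \<Rightarrow> nat \<Rightarrow> bool" where
  "is_schedule st M \<longleftrightarrow> (\<forall>i<n. st i + tau i \<le> M) \<and>
      (\<forall>i<n. \<forall>j<n. conf i j \<longrightarrow> st i + tau i \<le> st j \<or> st j + tau j \<le> st i)"

text \<open>Serial execution is a valid schedule, so the \<open>LEAST\<close> in
  \<open>opt_makespan\<close> ranges over a nonempty set and is attained.\<close>

lemma ex_opt_schedule: "\<exists>st. is_schedule st opt"
proof -
  define st where "st i = (\<Sum>k<i. tau k)" for i
  have seq: "st i + tau i \<le> st j" if "i < j" for i j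
  proof -
    have "st i + tau i = (\<Sum>k<Suc i. tau k)" by (simp add: st_def)
    also have "\<dots> \<le> st j" unfolding st_def using that by (intro sum_mono2) auto
    finally show ?thesis .
  qed
  have "is_schedule st (st n)"
    unfolding is_schedule_def using seq by (metis conflict_def linorder_neqE_nat)
  then have "\<exists>M st. is_schedule st M" by blast
  then show ?thesis
    unfolding opt_makespan_def is_schedule_def by (rule LeastI_ex)
qed

lemma tau_le_opt: "i < n \<Longrightarrow> tau i \<le> opt"
  using ex_opt_schedule unfolding is_schedule_def by fastforce

lemma opt_pos: "0 < opt"
  using tau_le_opt[OF n_pos] tau_pos[OF n_pos] by linarith

text \<open>Writers of one resource conflict pairwise, so an optimal schedule gives them disjoint
  intervals inside \<open>{..<opt}\<close>.\<close>

lemma sum_writers_le_opt: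
  assumes "X \<subseteq> {i. i < n \<and> r \<in> Rw i}"
  shows "(\<Sum>i\<in>X. tau i) \<le> opt"
proof -
  obtain st where st: "is_schedule st opt" using ex_opt_schedule by blast
  have fin: "finite X" using assms by (rule finite_subset) simp
  have disj: "{st i..<st i + tau i} \<inter> {st j..<st j + tau j} = {}"
    if "i \<in> X" "j \<in> X" "i \<noteq> j" for i j
  proof -
    have "conf i j" using that assms unfolding conflict_def RS_def by blast
    then have "st i + tau i \<le> st j \<or> st j + tau j \<le> st i"
      using st that assms unfolding is_schedule_def by blast
    then show ?thesis by auto
  qed
  have "(\<Sum>i\<in>X. tau i) = (\<Sum>i\<in>X. card {st i..<st i + tau i})" by simp
  also have "\<dots> = card (\<Union>i\<in>X. {st i..<st i + tau i})"
    using fin disj by (subst card_UN_disjoint) auto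
  also have "\<dots> \<le> card {..<opt}"
    using st assms unfolding is_schedule_def by (intro card_mono) fastforce+
  finally show ?thesis by simp
qed

section \<open>Group indices and the balancing ratio\<close>

lemma tau_range: "i < n \<Longrightarrow> tau_min n tau \<le> tau i \<and> tau i \<le> tau_max n tau"
  unfolding tau_min_def tau_max_def by simp

lemma tau_min_pos: "0 < tau_min n tau"
proof -
  have "tau_min n tau \<in> tau ` {..<n}"
    unfolding tau_min_def using n_pos by (intro Min_in) auto
  then show ?thesis using tau_pos by fastforce
qed

lemma ell_ge_1: "1 \<le> ell n tau"
proof -
  have "0 \<le> log 2 (real (tau_max n tau) / real (tau_min n tau))"
    using tau_min_pos tau_range[OF n_pos] by simp
  then show ?thesis unfolding ell_def by linarith
qed

text \<open>For a positive index, minimality makes its predecessor fail, so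
  \<open>2 ^ tgroup n tau i * tau_min n tau\<close> is at most \<open>tau i\<close>, hence at most
  \<open>tau_max n tau\<close>.\<close>

lemma tgroup_less_ell:
  assumes "i < n"
  shows "real (tgroup n tau i) + 1 \<le> ell n tau"
proof (cases "tgroup n tau i")
  case 0
  then show ?thesis using ell_ge_1 by simp
next
  case (Suc g)
  have "\<not> tau i < 2 ^ Suc g * tau_min n tau"
    using not_less_Least[of g "\<lambda>g. tau i < 2 ^ Suc g * tau_min n tau"] Suc
    unfolding tgroup_def by simp
  then have "2 ^ Suc g * tau_min n tau \<le> tau_max n tau"
    using tau_range[OF assms] by linarith
  then have "real (2 ^ Suc g * tau_min n tau) \<le> real (tau_max n tau)"
    by (simp only: of_nat_le_iff)
  then have "2 powr real (Suc g) \<le> real (tau_max n tau) / real (tau_min n tau)"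
    using tau_min_pos by (simp add: powr_realpow field_simps del: of_nat_Suc)
  then have "real (Suc g) \<le> log 2 (real (tau_max n tau) / real (tau_min n tau))"
    using tau_min_pos tau_range[OF n_pos] by (subst le_log_iff) auto
  then show ?thesis unfolding ell_def using Suc by linarith
qed

lemma lgroup_range:
  assumes "i < n"
  shows "2 ^ lgroup Rr Rw i \<le> card (RS Rr Rw i)" "card (RS Rr Rw i) < 2 * 2 ^ lgroup Rr Rw i"
proof -
  have "card (RS Rr Rw i) < 2 ^ Suc (card (RS Rr Rw i))"
    using less_exp[of "card (RS Rr Rw i)"] unfolding power_Suc by linarith
  then have "card (RS Rr Rw i) < 2 ^ Suc (lgroup Rr Rw i)"
    unfolding lgroup_def by (rule LeastI)
  then show "card (RS Rr Rw i) < 2 * 2 ^ lgroup Rr Rw i" by simp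
  have "0 < card (RS Rr Rw i)"
    using RS_ne[OF assms] RS_sub[OF assms] finite_subset by fastforce
  moreover have "\<not> card (RS Rr Rw i) < 2 ^ Suc j" if "lgroup Rr Rw i = Suc j" for j
    using not_less_Least[of j "\<lambda>j. card (RS Rr Rw i) < 2 ^ Suc j"] that
    unfolding lgroup_def by simp
  ultimately show "2 ^ lgroup Rr Rw i \<le> card (RS Rr Rw i)"
    by (cases "lgroup Rr Rw i") auto
qed

lemma card_RS_le: "i < n \<Longrightarrow> card (RS Rr Rw i) \<le> s"
  using card_mono[OF _ RS_sub] by fastforce

text \<open>A crude bound suffices: \<open>sum_class_bounds_le\<close> is uniform in the number of
  subgroups, so only finiteness matters.\<close>

lemma lgroup_le: "i < n \<Longrightarrow> lgroup Rr Rw i \<le> s"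
  using lgroup_range(1)[of i] card_RS_le[of i] less_exp[of "lgroup Rr Rw i"] by linarith

abbreviation \<beta> where "\<beta> \<equiv> beta n Rr Rw"

lemma beta_props:
  shows beta_le: "i < n \<Longrightarrow> writing Rw i \<Longrightarrow> \<beta> * card (RS Rr Rw i) \<le> card (Rw i)"
    and beta_pos: "0 < \<beta>" and beta_le_1: "\<beta> \<le> 1"
proof -
  let ?B = "{real (card (Rw i)) / real (card (RS Rr Rw i)) | i. i < n \<and> writing Rw i}"
  have B: "?B = (\<lambda>i. real (card (Rw i)) / real (card (RS Rr Rw i))) ` {i. i < n \<and> writing Rw i}"
    by blast
  have fin: "finite ?B" unfolding B by simp
  have ne: "?B \<noteq> {}" using ex_writing by blast
  have pos: "0 < card (RS Rr Rw i)" if "i < n" for i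
    using RS_ne[OF that] RS_sub[OF that] finite_subset by fastforce
  have finRS: "finite (RS Rr Rw i)" if "i < n" for i
    using RS_sub[OF that] finite_subset by blast
  show "\<beta> * card (RS Rr Rw i) \<le> card (Rw i)" if "i < n" "writing Rw i" for i
  proof -
    have "\<beta> \<le> real (card (Rw i)) / real (card (RS Rr Rw i))"
      unfolding beta_def using that fin by (intro Min_le) auto
    then show ?thesis using pos[OF that(1)] by (simp add: pos_le_divide_eq)
  qed
  have "\<beta> \<in> ?B" unfolding beta_def using fin ne by (rule Min_in)
  then obtain i where i: "i < n" "writing Rw i" "\<beta> = real (card (Rw i)) / real (card (RS Rr Rw i))"
    by blast
  have "Rw i \<subseteq> RS Rr Rw i" by (auto simp: RS_def)
  then have "0 < card (Rw i)" "card (Rw i) \<le> card (RS Rr Rw i)"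
    using finRS[OF i(1)] i(2) finite_subset by (auto simp: writing_def card_gt_0_iff intro: card_mono)
  then show "0 < \<beta>" "\<beta> \<le> 1"
    using i(3) pos[OF i(1)] by auto
qed

lemma s_pos: "1 \<le> s"
  using RS_ne[OF n_pos] RS_sub[OF n_pos] by fastforce

text \<open>Charging each transaction to the resources it writes: every resource absorbs at most
  \<open>opt\<close>, and each transaction of the class is charged at least \<open>\<beta> * 2 ^ j\<close> times.\<close>
lemma class_weight_le:
  assumes "X \<subseteq> {i. i < n \<and> writing Rw i \<and> lgroup Rr Rw i = j}"
  shows "\<beta> * 2 ^ j * real (\<Sum>i\<in>X. tau i) \<le> real s * real opt"
proof -
  have fin: "finite X" using assms by (rule finite_subset) simp
  have sub: "Rw i \<subseteq> {..<s}" if "i < n" for i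
    using RS_sub[OF that] by (auto simp: RS_def)
  have "\<beta> * 2 ^ j * real (\<Sum>i\<in>X. tau i) = (\<Sum>i\<in>X. \<beta> * 2 ^ j * real (tau i))"
    by (simp add: sum_distrib_left)
  also have "\<dots> \<le> (\<Sum>i\<in>X. real (card (Rw i)) * real (tau i))"
  proof (intro sum_mono mult_right_mono)
    fix i assume "i \<in> X"
    then have i: "i < n" "writing Rw i" "lgroup Rr Rw i = j" using assms by auto
    have "real (2 ^ j) \<le> real (card (RS Rr Rw i))"
      using lgroup_range(1)[OF i(1)] i(3) by (simp only: of_nat_le_iff)
    then have "\<beta> * 2 ^ j \<le> \<beta> * card (RS Rr Rw i)"
      using beta_pos by (intro mult_left_mono) auto
    then show "\<beta> * 2 ^ j \<le> real (card (Rw i))"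
      using beta_le[OF i(1,2)] by linarith
  qed simp
  also have "\<dots> = real (\<Sum>i\<in>X. card (Rw i) * tau i)"
    by simp
  also have "(\<Sum>i\<in>X. card (Rw i) * tau i) = (\<Sum>i\<in>X. \<Sum>r<s. if r \<in> Rw i then tau i else 0)"
  proof (rule sum.cong[OF refl])
    fix i assume "i \<in> X"
    then have "{r. r < s \<and> r \<in> Rw i} = Rw i" using sub assms by fastforce
    then show "card (Rw i) * tau i = (\<Sum>r<s. if r \<in> Rw i then tau i else 0)"
      by (simp add: sum.inter_filter[symmetric])
  qed
  also have "\<dots> = (\<Sum>r<s. \<Sum>i\<in>{i\<in>X. r \<in> Rw i}. tau i)"
    by (subst sum.swap) (simp add: sum.inter_filter fin)
  also have "\<dots> \<le> (\<Sum>r<s. opt)"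
    using assms by (intro sum_mono sum_writers_le_opt) auto
  finally show ?thesis by simp
qed

text \<open>Each counted \<open>k\<close> writes some resource of \<open>i\<close>; charging it to
  all such resources, each absorbs at most \<open>opt\<close> by
  \<open>sum_writers_le_opt\<close>.\<close>

lemma writers_load_le:
  assumes "i < n" "X \<subseteq> {i. i < n}"
  shows "(\<Sum>k\<in>X. if i \<noteq> k \<and> Rw k \<inter> RS Rr Rw i \<noteq> {} then tau k else 0) \<le> card (RS Rr Rw i) * opt"
proof -
  have fin: "finite X" using assms(2) by (rule finite_subset) simp
  have finRS: "finite (RS Rr Rw i)"
    using RS_sub[OF assms(1)] finite_subset by blast
  have "(\<Sum>k\<in>X. if i \<noteq> k \<and> Rw k \<inter> RS Rr Rw i \<noteq> {} then tau k else 0)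
      \<le> (\<Sum>k\<in>X. \<Sum>r\<in>RS Rr Rw i. if r \<in> Rw k then tau k else 0)"
  proof (rule sum_mono)
    fix k assume "k \<in> X"
    show "(if i \<noteq> k \<and> Rw k \<inter> RS Rr Rw i \<noteq> {} then tau k else 0)
      \<le> (\<Sum>r\<in>RS Rr Rw i. if r \<in> Rw k then tau k else 0)"
    proof (cases "i \<noteq> k \<and> Rw k \<inter> RS Rr Rw i \<noteq> {}")
      case True
      then obtain r where "r \<in> RS Rr Rw i" "r \<in> Rw k" by blast
      then show ?thesis
        using True member_le_sum[of r "RS Rr Rw i" "\<lambda>r. if r \<in> Rw k then tau k else 0"] finRS by auto
    qed auto
  qed
  also have "\<dots> = (\<Sum>r\<in>RS Rr Rw i. \<Sum>k\<in>{k\<in>X. r \<in> Rw k}. tau k)"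
    by (subst sum.swap) (simp add: sum.inter_filter fin)
  also have "\<dots> \<le> (\<Sum>r\<in>RS Rr Rw i. opt)"
    using assms(2) by (intro sum_mono sum_writers_le_opt) auto
  finally show ?thesis by simp
qed

section \<open>Active time of each subgroup and of the read-only group\<close>

definition in_class :: "nat \<Rightarrow> nat \<Rightarrow> nat \<Rightarrow> bool" where
  "in_class g j i \<longleftrightarrow> i < n \<and> writing Rw i \<and> tgroup n tau i = g \<and> lgroup Rr Rw i = j"

text \<open>The cutoff \<open>M\<close> keeps the set finite while termination is still
  unproved.\<close>

definition active_steps :: "nat \<Rightarrow> nat \<Rightarrow> nat \<Rightarrow> nat set" where
  "active_steps M g j = {t. t < M \<and> (\<exists>i\<in>Th t. in_class g j i)}"

text \<open>Minimality of both transactions gives \<open>le\<close> in both directions, which forces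
  equal indices; conversely, \<open>le\<close> depends only on the class.\<close>

lemma Th_class:
  assumes "i \<in> Th t" "in_class g j i" "k \<in> P t"
  shows "k \<in> Th t \<longleftrightarrow> in_class g j k"
proof -
  have k: "k < n" using assms(3) by (simp add: pending_def)
  have ik: "le i k" using assms unfolding low_pending_def by blast
  show ?thesis
  proof
    assume "k \<in> Th t"
    then have "le k i" using assms(1) unfolding low_pending_def by blast
    then show "in_class g j k"
      using ik assms(2) k unfolding cls_le_def in_class_def by linarith
  next
    assume "in_class g j k"
    then have "le k x = le i x" for x
      using assms(2) unfolding cls_le_def in_class_def by metis
    then show "k \<in> Th t" using assms(1,3) unfolding low_pending_def by simp
  qed
qed

lemma active_steps_le:
  "real (card (active_steps M g j)) \<le> real opt * (4 * real k * 2 ^ j + real s / \<beta> / (2 ^ j * 2 ^ k))"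
proof (cases "active_steps M g j = {}")
  case True
  then show ?thesis using beta_pos by simp
next
  case False
  let ?X = "active_steps M g j"
  have fin: "finite ?X" unfolding active_steps_def by simp
  define a b where "a = Min ?X" and "b = Max ?X"
  define m where "m = Suc b - a"
  have "a \<in> ?X" "b \<in> ?X" unfolding a_def b_def using fin False by auto
  then obtain i\<^sub>a i\<^sub>b where ia: "i\<^sub>a \<in> Th a" "in_class g j i\<^sub>a" and ib: "i\<^sub>b \<in> Th b" "in_class g j i\<^sub>b"
    unfolding active_steps_def by blast
  \<comment> \<open>A member pending at the last active step \<open>b\<close> is pending since
    \<open>a\<close>, where its class is lowest, so the class stays lowest throughout and the active
    steps have no gaps.\<close>
  have ib_Th: "i\<^sub>b \<in> Th (a + u)" if "u < m" for u
  proof -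
    have "i\<^sub>b \<in> P b" using ib(1) Th_sub by blast
    moreover have "a + u \<le> b" using that by (simp add: m_def)
    ultimately have P: "i\<^sub>b \<in> P a" "i\<^sub>b \<in> P (a + u)"
      using P_anti[of a b] P_anti[of "a + u" b] by auto
    then have "i\<^sub>b \<in> Th a" using Th_class[OF ia] ib(2) by blast
    then show ?thesis using Th_persist[of i\<^sub>b a "a + u"] P by simp
  qed
  define H where "H u = {i\<in>P (a + u). in_class g j i}" for u
  have H_Th: "H u = Th (a + u)" if "u < m" for u
    using Th_class[OF ib_Th[OF that] ib(2)] Th_sub unfolding H_def by blast
  have H_P: "H u \<subseteq> P (a + u)" for u unfolding H_def by blast
  \<comment> \<open>The edge points from \<open>i\<close> to a transaction writing a resource of
    \<open>i\<close>; every conflict has such an orientation in at least one direction.\<close>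
  interpret phase H "\<lambda>u. high (a + u)" "\<lambda>i k. i \<noteq> k \<and> Rw k \<inter> RS Rr Rw i \<noteq> {}" tau m
    "2 * 2 ^ j * opt"
  proof
    fix t show "finite (H t)" unfolding H_def using finite_P by simp
  next
    fix t t' :: nat assume "t \<le> t'"
    then show "H t' \<subseteq> H t" using P_anti[of "a + t" "a + t'"] unfolding H_def by auto
  next
    fix t assume "t < m"
    then show "H t \<noteq> {}" "high (a + t) \<subseteq> H t"
      using ib_Th[of t] H_Th[of t] high_sub by blast+
  next
    fix i t t' assume "i \<in> high (a + t)" "t \<le> t'" "i \<in> H t'"
    then show "i \<in> high (a + t')"
      using high_run[of i "a + t" "a + t'"] H_P by auto
  next
    fix i
    have "card {t. t < m \<and> i \<in> high (a + t)} = card ((+) a ` {t. t < m \<and> i \<in> high (a + t)})"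
      by (simp add: card_image)
    also have "\<dots> \<le> card {t\<in>{a..<a+m}. i \<in> high t}"
      by (intro card_mono) auto
    also have "\<dots> \<le> tau i" by (rule card_high_le)
    finally show "card {t. t < m \<and> i \<in> high (a + t)} \<le> tau i" .
  next
    fix t i assume "t < m" "i \<in> H t - high (a + t)"
    then obtain k where "k \<in> high (a + t)" "conf k i"
      using high_or_blocked[of i "a + t"] H_Th[of t] by blast
    then show "\<exists>k\<in>high (a + t). (i \<noteq> k \<and> Rw k \<inter> RS Rr Rw i \<noteq> {}) \<or> (k \<noteq> i \<and> Rw i \<inter> RS Rr Rw k \<noteq> {})"
      unfolding conflict_def Int_commute[of "RS Rr Rw k"] by (intro bexI[of _ k]) auto
  next
    fix i assume "i \<in> H 0"
    then have i: "i < n" "lgroup Rr Rw i = j" unfolding H_def in_class_def by auto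
    have "H 0 \<subseteq> {i. i < n}" unfolding H_def in_class_def by auto
    then have "tau i + (\<Sum>k\<in>H 0. if i \<noteq> k \<and> Rw k \<inter> RS Rr Rw i \<noteq> {} then tau k else 0)
      \<le> opt + card (RS Rr Rw i) * opt"
      using writers_load_le[OF i(1)] tau_le_opt[OF i(1)] add_mono by blast
    also have "\<dots> = Suc (card (RS Rr Rw i)) * opt" by simp
    \<comment> \<open>The strict bound on the number of resources leaves room for the extra
      \<open>opt\<close> that pays for \<open>tau i\<close> itself.\<close>
    also have "\<dots> \<le> 2 * 2 ^ j * opt"
      using lgroup_range(2)[OF i(1)] i(2) by (intro mult_right_mono) auto
    finally show "tau i + (\<Sum>k\<in>H 0. if i \<noteq> k \<and> Rw k \<inter> RS Rr Rw i \<noteq> {} then tau k else 0)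
      \<le> 2 * 2 ^ j * opt" .
  qed
  have "?X \<subseteq> {a..b}" unfolding a_def b_def using fin by auto
  then have "card ?X \<le> m"
    unfolding m_def using card_mono[of "{a..b}"] by fastforce
  then have "real (card ?X) \<le> real m" by simp
  also have "\<dots> \<le> 2 * real (2 * 2 ^ j * opt) * real k + real (W 0) / 2 ^ k"
    using opt_pos by (intro length_le) simp
  also have "\<dots> \<le> 2 * real (2 * 2 ^ j * opt) * real k + real s * real opt / (\<beta> * 2 ^ j) / 2 ^ k"
  proof (intro add_left_mono divide_right_mono)
    have "\<beta> * 2 ^ j * real (W 0) \<le> real s * real opt"
      unfolding W_def by (rule class_weight_le) (auto simp: H_def in_class_def)
    then show "real (W 0) \<le> real s * real opt / (\<beta> * 2 ^ j)"
      using beta_pos by (simp add: pos_le_divide_eq mult.commute)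
  qed simp
  also have "\<dots> = real opt * (4 * real k * 2 ^ j + real s / \<beta> / (2 ^ j * 2 ^ k))"
    by (simp add: field_simps)
  finally show ?thesis .
qed

definition readonly_steps :: "nat \<Rightarrow> nat set" where
  "readonly_steps M = {t. t < M \<and> (\<exists>i\<in>Th t. \<not> writing Rw i)}"

text \<open>In these steps only read-only transactions are pending, so nothing conflicts and
  maximality gives all of them high priority. One that is pending at the last such step has high
  priority at all of them.\<close>

lemma readonly_steps_le: "card (readonly_steps M) \<le> opt"
proof (cases "readonly_steps M = {}")
  case False
  let ?X = "readonly_steps M"
  have fin: "finite ?X" unfolding readonly_steps_def by simp
  have all_readonly: "Th t = P t \<and> (\<forall>k\<in>P t. \<not> writing Rw k)" if t: "t \<in> ?X" for t
  proof -
    obtain i where "i \<in> Th t" "\<not> writing Rw i" using t unfolding readonly_steps_def by blast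
    then show ?thesis unfolding low_pending_def cls_le_def by blast
  qed
  have X: "Max ?X \<in> ?X" using fin False by simp
  then obtain i where "i \<in> Th (Max ?X)" unfolding readonly_steps_def by blast
  then have i: "i \<in> P (Max ?X)" using Th_sub by blast
  have "i \<in> high t" if t: "t \<in> ?X" for t
  proof (rule ccontr)
    have iP: "i \<in> P t" using i P_anti[of t "Max ?X"] fin t by auto
    assume "i \<notin> high t"
    then obtain k where "k \<in> high t" "conf k i"
      using high_or_blocked[of i t] all_readonly[OF t] iP by blast
    then show False
      using all_readonly[OF t] iP high_sub[of t] unfolding conflict_def writing_def by blast
  qed
  then have "?X = {t\<in>?X. i \<in> high t}" by blast
  then have "card ?X \<le> tau i" using card_high_le[of ?X i] by simp
  then show ?thesis using tau_le_opt[of i] i by (simp add: pending_def)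
qed simp

text \<open>Stated for any prefix with pending transactions, so that it yields termination as well
  as the makespan bound. The summand 1 pays for the read-only steps.\<close>

lemma steps_le:
  assumes "\<And>t. t < M \<Longrightarrow> P t \<noteq> {}"
  shows "real M \<le> (32 * ell n tau * sqrt (real s / \<beta>) + 1) * real opt"
proof -
  define G where "G = nat \<lceil>log 2 (real (tau_max n tau) / real (tau_min n tau))\<rceil> + 1"
  have G: "real G = ell n tau"
    using ell_ge_1 unfolding G_def ell_def by simp
  define Q where "Q = sqrt (real s / \<beta>)"
  have "\<beta> \<le> real s" using s_pos beta_le_1 by simp
  then have sb: "1 \<le> real s / \<beta>" using beta_pos by simp
  then have Q: "1 \<le> Q" "Q\<^sup>2 = real s / \<beta>" unfolding Q_def by auto
  have cover: "{..<M} \<subseteq> readonly_steps M \<union> (\<Union>g<G. \<Union>j<Suc s. active_steps M g j)"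
  proof
    fix t assume t: "t \<in> {..<M}"
    then obtain i where i: "i \<in> Th t" using assms Th_ne by fastforce
    then have "i < n" using Th_sub by (auto simp: pending_def)
    moreover have "tgroup n tau i < G"
      using tgroup_less_ell[OF \<open>i < n\<close>] G by linarith
    moreover have "lgroup Rr Rw i < Suc s"
      using lgroup_le[OF \<open>i < n\<close>] by simp
    moreover have "t \<in> active_steps M (tgroup n tau i) (lgroup Rr Rw i)" if "writing Rw i"
      using t i \<open>i < n\<close> that unfolding active_steps_def in_class_def by blast
    moreover have "t \<in> readonly_steps M" if "\<not> writing Rw i"
      using t i that unfolding readonly_steps_def by blast
    ultimately show "t \<in> readonly_steps M \<union> (\<Union>g<G. \<Union>j<Suc s. active_steps M g j)"
      by blast
  qed
  have fin: "finite (active_steps M g j)" "finite (readonly_steps M)" for g j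
    unfolding active_steps_def readonly_steps_def by simp_all
  have "M \<le> card (readonly_steps M \<union> (\<Union>g<G. \<Union>j<Suc s. active_steps M g j))"
    using card_mono[OF _ cover] fin by fastforce
  also have "\<dots> \<le> card (readonly_steps M) + card (\<Union>g<G. \<Union>j<Suc s. active_steps M g j)"
    by (rule card_Un_le)
  also have "\<dots> \<le> opt + (\<Sum>g<G. \<Sum>j<Suc s. card (active_steps M g j))"
    by (intro add_mono readonly_steps_le order_trans[OF card_UN_le] sum_mono card_UN_le) auto
  finally have "real M \<le> real opt + (\<Sum>g<G. \<Sum>j<Suc s. real (card (active_steps M g j)))"
    by (simp only: of_nat_sum[symmetric] of_nat_add[symmetric] of_nat_le_iff)
  also have "\<dots> \<le> real opt + (\<Sum>g<G. 32 * Q * real opt)"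
  proof (intro add_left_mono sum_mono)
    fix g
    \<comment> \<open>Dividing by \<open>opt\<close> normalises the subgroup bounds to the form
      required by \<open>sum_class_bounds_le\<close>.\<close>
    have "(\<Sum>j<Suc s. real (card (active_steps M g j)) / real opt) \<le> 32 * Q"
    proof (rule sum_class_bounds_le[OF Q(1)])
      fix j k
      show "real (card (active_steps M g j)) / real opt \<le> 4 * real k * 2 ^ j + Q\<^sup>2 / (2 ^ j * 2 ^ k)"
        using active_steps_le[of M g j k] opt_pos unfolding Q(2)
        by (simp add: pos_divide_le_eq mult.commute)
    qed
    then show "(\<Sum>j<Suc s. real (card (active_steps M g j))) \<le> 32 * Q * real opt"
      using opt_pos by (simp only: sum_divide_distrib[symmetric] pos_divide_le_eq of_nat_0_less_iff)
  qed
  also have "\<dots> = (32 * ell n tau * Q + 1) * real opt"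
    by (simp add: G algebra_simps)
  finally show ?thesis unfolding Q_def .
qed

lemma all_committed_iff: "all_committed n cm t \<longleftrightarrow> P t = {}"
  unfolding all_committed_def pending_def by auto

lemma competitive:
  "(\<exists>t. all_committed n cm t) \<and>
    real (clair_makespan n cm) / real opt \<le> 32 * ell n tau * sqrt (real s / \<beta>) + 1"
proof
  let ?R = "(32 * ell n tau * sqrt (real s / \<beta>) + 1) * real opt"
  show "\<exists>t. all_committed n cm t"
  proof (rule ccontr)
    assume "\<nexists>t. all_committed n cm t"
    \<comment> \<open>Without termination every \<open>M\<close> would be a prefix with pending
      transactions, contradicting the fixed bound.\<close>
    then have "real M \<le> ?R" for M
      using steps_le[of M] all_committed_iff by blast
    then show False using reals_Archimedean2[of ?R] by (meson not_less)
  qed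
  have "P t \<noteq> {}" if "t < clair_makespan n cm" for t
    using not_less_Least[of t "all_committed n cm"] that all_committed_iff
    unfolding clair_makespan_def by blast
  then have "real (clair_makespan n cm) \<le> ?R"
    by (rule steps_le)
  then show "real (clair_makespan n cm) / real opt \<le> 32 * ell n tau * sqrt (real s / \<beta>) + 1"
    using opt_pos by (simp add: pos_divide_le_eq)
qed

end

theorem mainTheorem5:
  fixes n s :: nat and Rr Rw :: "nat \<Rightarrow> nat set" and tau :: "nat \<Rightarrow> nat"
    and cm :: "nat \<Rightarrow> nat \<Rightarrow> bool" and prog :: "nat \<Rightarrow> nat \<Rightarrow> nat"
    and I :: "nat \<Rightarrow> nat set" and victim :: "nat \<Rightarrow> nat \<Rightarrow> nat \<Rightarrow> nat"
  assumes "workload n s Rr Rw tau"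
    and "clairvoyant_run n Rr Rw tau cm prog I victim"
  shows "(\<exists>t. all_committed n cm t) \<and>
    real (clair_makespan n cm) / real (opt_makespan n Rr Rw tau)
      \<le> 32 * ell n tau * sqrt (real s / beta n Rr Rw) + 1"
proof -
  interpret execution n s Rr Rw tau cm prog I victim
    by standard (rule assms)+
  show ?thesis by (rule competitive)
qed

end
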